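(* Let $G$ be a finite simple undirected chordal graph with clique number $\omega_G$, and let $x$ be a vertex of $G$. Then $b(G-\{x\}) \geq b(G) - \omega_G$.
   Context: A graph is chordal if every cycle of length at least $4$ has a chord. The clique number is the maximum order of a clique. A proper coloring of the vertices of a graph is a b-coloring if every color class contains a vertex adjacent to at least one vertex of every other color class. The b-chromatic number $b(G)$ is the largest integer $k$ such that $G$ admits a b-coloring with $k$ colors. $G-\{x\}$ denotes the graph obtained from $G$ by deleting $x$ and all edges incident to $x$. *)

theory Defs
  imports "Graph_Theory.Graph_Theory"
begin

text \<open>
  Finite simple undirected graphs are finite, symmetric, loop-free digraphs without parallel
  arcs (locale \<^locale>\<open>graph\<close>): an edge is a pair of opposite arcs, and adjacency is
  \<open>u \<rightarrow>\<^bsub>G\<^esub> v\<close>. Vertex deletion is \<^const>\<open>pre_digraph.del_vert\<close>.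
\<close>

text \<open>
  A directed cycle \<open>p\<close> (a list of arcs) with at least three arcs is an undirected cycle traversed
  in one direction; its vertices are the tails of its arcs. Both orientations of its edges have
  to be excluded, since only one of them occurs in \<open>p\<close>.
\<close>

definition has_chord :: "('a, 'b) pre_digraph \<Rightarrow> 'b list \<Rightarrow> bool" where
  "has_chord G p \<longleftrightarrow>
     (\<exists>u \<in> tail G ` set p. \<exists>v \<in> tail G ` set p. u \<rightarrow>\<^bsub>G\<^esub> v \<and>
        (u, v) \<notin> arc_to_ends G ` set p \<and> (v, u) \<notin> arc_to_ends G ` set p)"

definition chordal :: "('a, 'b) pre_digraph \<Rightarrow> bool" where
  "chordal G \<longleftrightarrow> (\<forall>p. pre_digraph.cycle G p \<and> 4 \<le> length p \<longrightarrow> has_chord G p)"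

definition is_clique :: "('a, 'b) pre_digraph \<Rightarrow> 'a set \<Rightarrow> bool" where
  "is_clique G K \<longleftrightarrow> K \<subseteq> verts G \<and> (\<forall>u \<in> K. \<forall>v \<in> K. u \<noteq> v \<longrightarrow> u \<rightarrow>\<^bsub>G\<^esub> v)"

definition clique_number :: "('a, 'b) pre_digraph \<Rightarrow> nat" where
  "clique_number G = Max {card K | K. is_clique G K}"

definition proper_coloring :: "('a, 'b) pre_digraph \<Rightarrow> ('a \<Rightarrow> nat) \<Rightarrow> bool" where
  "proper_coloring G c \<longleftrightarrow>
     (\<forall>u \<in> verts G. \<forall>v \<in> verts G. u \<rightarrow>\<^bsub>G\<^esub> v \<longrightarrow> c u \<noteq> c v)"

text \<open>
  The colors are \<open>0, \<dots>, k - 1\<close>. All of them are used, because each of the \<open>k\<close> color classes is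
  required to contain a vertex with a neighbor in every other class.
\<close>

definition b_coloring :: "('a, 'b) pre_digraph \<Rightarrow> nat \<Rightarrow> ('a \<Rightarrow> nat) \<Rightarrow> bool" where
  "b_coloring G k c \<longleftrightarrow>
     c ` verts G \<subseteq> {..<k} \<and> proper_coloring G c \<and>
     (\<forall>i < k. \<exists>v \<in> verts G. c v = i \<and>
        (\<forall>j < k. j \<noteq> i \<longrightarrow> (\<exists>w \<in> verts G. v \<rightarrow>\<^bsub>G\<^esub> w \<and> c w = j)))"

text \<open>
  On a finite loop-free graph the maximum is over a finite nonempty set: \<open>k\<close> is at most the
  number of vertices, and a proper coloring with as few colors as possible is a b-coloring.
  The graph without vertices has b-chromatic number 0.
\<close>

definition b_chromatic_number :: "('a, 'b) pre_digraph \<Rightarrow> nat" where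
  "b_chromatic_number G = Max {k. \<exists>c. b_coloring G k c}"

end

theory Submission
  imports Defs
begin

text \<open>
  Fix a b-coloring of \<open>G\<close> with the maximum number \<open>k\<close> of colors, let \<open>z\<close> be the color of \<open>x\<close>, and let
  \<open>M\<close> be the set of colors other than \<open>z\<close> that lose all their b-vertices when \<open>x\<close> is deleted; those
  b-vertices are neighbors of \<open>x\<close>. If \<open>M\<close> has fewer than \<open>\<omega>\<close> elements, dissolve the color classes of
  \<open>M\<close> and, if necessary, that of \<open>z\<close>. Otherwise \<open>z\<close> can be eliminated from \<open>G - x\<close> at no further
  cost, leaving \<open>k - 1\<close> colors: sweep through \<open>G\<close> starting at \<open>x\<close>, so that the unswept components
  are always attached to cliques. When a vertex \<open>v\<close> of color \<open>z\<close> is reached, it is complete to the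
  clique \<open>K\<close> attaching its component \<open>F\<close>, so \<open>K\<close> has fewer than \<open>\<omega>\<close> vertices and some \<open>j \<in> M\<close> is not
  a color of \<open>K\<close>. Exchanging \<open>z\<close> and \<open>j\<close> in \<open>F\<close> then destroys no b-vertex with respect to the colors
  other than \<open>z\<close>.
\<close>

section \<open>Connected vertex sets\<close>

text \<open>The component of \<open>v\<close> in the subgraph induced by \<open>F\<close>. The
  closure is reflexive, so for \<open>v\<close> outside \<open>F\<close> it is
  \<open>{v}\<close>.\<close>

definition comp_of :: "('a, 'b) pre_digraph \<Rightarrow> 'a set \<Rightarrow> 'a \<Rightarrow> 'a set" where
  "comp_of G F v = {w. (v, w) \<in> (arcs_ends G \<inter> F \<times> F)\<^sup>*}"

definition connected_on :: "('a, 'b) pre_digraph \<Rightarrow> 'a set \<Rightarrow> bool" where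
  "connected_on G F \<longleftrightarrow> (\<forall>a \<in> F. \<forall>b \<in> F. (a, b) \<in> (arcs_ends G \<inter> F \<times> F)\<^sup>*)"

lemma comp_of_self: "v \<in> comp_of G F v"
  by (simp add: comp_of_def)

lemma comp_of_mono: "F \<subseteq> F' \<Longrightarrow> comp_of G F v \<subseteq> comp_of G F' v"
  unfolding comp_of_def by (auto elim: rtrancl_mono[THEN subsetD, rotated])

lemma comp_of_subset: "v \<in> F \<Longrightarrow> comp_of G F v \<subseteq> F"
proof
  fix w assume "v \<in> F" "w \<in> comp_of G F v"
  then show "w \<in> F" by (auto simp: comp_of_def elim: rtranclE)
qed

lemma comp_of_step:
  assumes "v \<in> F" "w \<in> comp_of G F v" "w \<rightarrow>\<^bsub>G\<^esub> z" "z \<in> F"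
  shows "z \<in> comp_of G F v"
  using assms comp_of_subset[of v F G] unfolding comp_of_def
  by (auto intro: rtrancl_into_rtrancl)

lemma (in loopfree_digraph) dominates_irrefl: "\<not> u \<rightarrow> u"
  using no_loops by (auto simp: arcs_ends_conv)

context sym_digraph
begin

lemma dominates_sym: "u \<rightarrow> v \<Longrightarrow> v \<rightarrow> u"
  using sym_arcs unfolding symmetric_def by (auto dest: symD)

lemma rtrancl_within_sym:
  "(a, b) \<in> (arcs_ends G \<inter> F \<times> F)\<^sup>* \<Longrightarrow> (b, a) \<in> (arcs_ends G \<inter> F \<times> F)\<^sup>*"
  by (rule symD[OF sym_rtrancl]) (auto intro!: symI dominates_sym)

lemma comp_of_eq: "w \<in> comp_of G F v \<Longrightarrow> comp_of G F w = comp_of G F v"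
  unfolding comp_of_def by (auto intro: rtrancl_trans rtrancl_within_sym)

text \<open>A walk inside \<open>F\<close> that starts at \<open>v\<close> never leaves the
  component of \<open>v\<close>, and any two members are joined through \<open>v\<close>.\<close>

lemma connected_on_comp_of:
  assumes "v \<in> F"
  shows "connected_on G (comp_of G F v)"
proof -
  let ?C = "comp_of G F v"
  have *: "(v, w) \<in> (arcs_ends G \<inter> ?C \<times> ?C)\<^sup>*" if "(v, w) \<in> (arcs_ends G \<inter> F \<times> F)\<^sup>*" for w
    using that
  proof (induction rule: rtrancl_induct)
    case (step y z)
    then have "y \<in> ?C" "z \<in> ?C" by (auto simp: comp_of_def intro: rtrancl_into_rtrancl)
    with step show ?case by (auto intro: rtrancl_into_rtrancl)
  qed simp
  show ?thesis
    unfolding connected_on_def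
  proof (intro ballI)
    fix a b assume "a \<in> ?C" "b \<in> ?C"
    then have "(v, a) \<in> (arcs_ends G \<inter> ?C \<times> ?C)\<^sup>*" "(v, b) \<in> (arcs_ends G \<inter> ?C \<times> ?C)\<^sup>*"
      using * by (auto simp: comp_of_def)
    then show "(a, b) \<in> (arcs_ends G \<inter> ?C \<times> ?C)\<^sup>*"
      by (rule rtrancl_trans[OF rtrancl_within_sym])
  qed
qed

lemma connected_on_insert:
  assumes "connected_on G C" "a \<in> C" "a \<rightarrow> w"
  shows "connected_on G (insert w C)"
proof -
  let ?R = "(arcs_ends G \<inter> insert w C \<times> insert w C)\<^sup>*"
  have C: "(p, q) \<in> ?R" if "p \<in> C" "q \<in> C" for p q
    using assms(1) that rtrancl_mono[of "arcs_ends G \<inter> C \<times> C" "arcs_ends G \<inter> insert w C \<times> insert w C"]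
    unfolding connected_on_def by blast
  have aw: "(a, w) \<in> ?R" using assms by auto
  have to_w: "(p, w) \<in> ?R" if "p \<in> insert w C" for p
    using C[of p a] aw assms(2) that by (auto intro: rtrancl_trans)
  show ?thesis
    unfolding connected_on_def
    by (intro ballI rtrancl_trans[OF to_w rtrancl_within_sym[OF to_w]])
qed

end

section \<open>Chordal graphs\<close>

context wf_digraph
begin

text \<open>Chordality is defined through arc lists, while paths are easier to handle as vertex
  lists. The last equation records the ends of the arcs, which decide what counts as a
  chord.\<close>

lemma successively_imp_arcs:
  assumes "vs \<noteq> []" "successively (dominates G) vs"
  shows "\<exists>p. set p \<subseteq> arcs G \<and> cas (hd vs) p (last vs) \<and> awalk_verts (hd vs) p = vs \<and>
    map (arc_to_ends G) p = zip (butlast vs) (tl vs)"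
  using assms
proof (induction vs rule: induct_list012)
  case (2 v)
  then show ?case by (intro exI[of _ "[]"]) auto
next
  case (3 u v vs)
  then obtain p where p: "set p \<subseteq> arcs G" "cas v p (last (v # vs))" "awalk_verts v p = v # vs"
    "map (arc_to_ends G) p = zip (butlast (v # vs)) vs"
    by auto
  have butlast: "butlast (u # v # vs) = u # butlast (v # vs)" by simp
  from 3 obtain e where "e \<in> arcs G" "tail G e = u" "head G e = v" "arc_to_ends G e = (u, v)"
    by (auto simp: arcs_ends_def arc_to_ends_def)
  with p show ?case
    unfolding butlast by (intro exI[of _ "e # p"]) (simp del: butlast.simps)
qed simp

end

text \<open>A chord avoids both orientations of the cycle edges, so its positions are neither
  consecutive nor the first and the last. Symmetry of adjacency puts the smaller position
  first.\<close>

lemma (in graph) chordal_obtain_chord: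
  assumes "chordal G" "distinct ws" "4 \<le> length ws"
    and adj: "\<And>i. Suc i < length ws \<Longrightarrow> ws ! i \<rightarrow> ws ! Suc i" and closing: "last ws \<rightarrow> hd ws"
  obtains i j where "Suc i < j" "j < length ws" "\<not> (i = 0 \<and> Suc j = length ws)" "ws ! i \<rightarrow> ws ! j"
proof -
  let ?n = "length ws"
  define vs where "vs = ws @ [hd ws]"
  have ne: "ws \<noteq> []" using assms by auto
  have "successively (dominates G) ws" using adj by (simp add: successively_conv_nth)
  then have "successively (dominates G) vs"
    using closing by (simp add: vs_def successively_append_iff)
  then obtain p where p: "set p \<subseteq> arcs G" "cas (hd vs) p (last vs)" "awalk_verts (hd vs) p = vs"
    "map (arc_to_ends G) p = zip (butlast vs) (tl vs)"
    using successively_imp_arcs[of vs] by (auto simp: vs_def)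
  have ends: "map (arc_to_ends G) p = zip ws (tl ws @ [hd ws])"
    using p(4) ne by (simp add: vs_def)
  then have len: "length p = ?n"
    using ne by (auto dest: arg_cong[where f = length])
  have "map (tail G) p = map fst (map (arc_to_ends G) p)" by (simp add: arc_to_ends_def)
  also have "\<dots> = ws" using ne unfolding ends by simp
  finally have tails: "tail G ` set p = set ws" by (metis set_map)
  have hd: "hd vs = hd ws" "last vs = hd ws" using ne by (auto simp: vs_def)
  have "hd ws \<in> verts G" using closing by (auto dest: adj_in_verts)
  with p hd have "awalk (hd ws) p (hd ws)" by (auto simp: awalk_def)
  moreover have "distinct (tl (awalk_verts (hd ws) p))"
    using p(3) hd \<open>distinct ws\<close> ne by (cases ws) (auto simp: vs_def)
  moreover have "p \<noteq> []" using len ne by auto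
  ultimately have "cycle p" unfolding cycle_def by blast
  with \<open>chordal G\<close> len assms(3) have "has_chord G p" by (simp add: chordal_def)
  then obtain u v where uv: "u \<in> set ws" "v \<in> set ws" "u \<rightarrow> v"
    "(u, v) \<notin> set (zip ws (tl ws @ [hd ws]))" "(v, u) \<notin> set (zip ws (tl ws @ [hd ws]))"
    unfolding has_chord_def tails by (metis ends set_map)
  obtain i j where ij: "i < ?n" "u = ws ! i" "j < ?n" "v = ws ! j"
    using uv by (auto simp: in_set_conv_nth)
  have consecutive: "(ws ! k, ws ! Suc k) \<in> set (zip ws (tl ws @ [hd ws]))" if "Suc k < ?n" for k
    using that by (auto simp: set_zip nth_append nth_tl intro!: exI[of _ k])
  have wrap: "(ws ! (?n - 1), ws ! 0) \<in> set (zip ws (tl ws @ [hd ws]))"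
    using ne by (auto simp: set_zip nth_append hd_conv_nth intro!: exI[of _ "?n - 1"])
  have "i \<noteq> j" using uv(3) ij dominates_irrefl by auto
  moreover have "j \<noteq> Suc i" "i \<noteq> Suc j" using uv ij consecutive by auto
  moreover have "\<not> (i = 0 \<and> Suc j = ?n)" "\<not> (j = 0 \<and> Suc i = ?n)"
    using uv ij wrap by (metis diff_Suc_1)+
  ultimately consider "Suc i < j" | "Suc j < i" by linarith
  then show thesis
  proof cases
    case 1
    then show thesis using that[of i j] ij uv \<open>\<not> (i = 0 \<and> Suc j = ?n)\<close> by auto
  next
    case 2
    then show thesis
      using that[of j i] ij dominates_sym[OF uv(3)] \<open>\<not> (j = 0 \<and> Suc i = ?n)\<close> by auto
  qed
qed

section \<open>Connected sets and the cliques around them\<close>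

lemma rtrancl_within_imp_list:
  assumes "(a, b) \<in> (R \<inter> F \<times> F)\<^sup>*" "a \<in> F"
  shows "\<exists>ps. ps \<noteq> [] \<and> hd ps = a \<and> last ps = b \<and> set ps \<subseteq> F \<and>
    successively (\<lambda>u v. (u, v) \<in> R) ps"
  using assms
proof (induction rule: rtrancl_induct)
  case base
  then show ?case by (intro exI[of _ "[a]"]) auto
next
  case (step y z)
  then obtain ps where "ps \<noteq> []" "hd ps = a" "last ps = y" "set ps \<subseteq> F"
    "successively (\<lambda>u v. (u, v) \<in> R) ps"
    by auto
  with step show ?case by (intro exI[of _ "ps @ [z]"]) (auto simp: successively_append_iff)
qed

context graph
begin

text \<open>A shortest path through \<open>F\<close> from the neighbors of \<open>u\<close> to those of \<open>u'\<close> closes up to a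
  chordless cycle through \<open>u\<close> and \<open>u'\<close>, unless it is a single vertex.\<close>

lemma chordal_common_neighbor:
  assumes "chordal G" "connected_on G F" "u \<rightarrow> u'" "u \<notin> F" "u' \<notin> F"
    and "a \<in> F" "u \<rightarrow> a" "b \<in> F" "u' \<rightarrow> b"
  obtains w where "w \<in> F" "u \<rightarrow> w" "u' \<rightarrow> w"
proof -
  \<comment> \<open>Repetitions are allowed in \<open>P\<close>; minimal length excludes them
    together with all shortcuts.\<close>
  define P where "P ps \<longleftrightarrow> ps \<noteq> [] \<and> set ps \<subseteq> F \<and> successively (dominates G) ps \<and>
    u \<rightarrow> hd ps \<and> u' \<rightarrow> last ps" for ps
  have "\<exists>ps. P ps"
    using rtrancl_within_imp_list[of a b "arcs_ends G" F] assms
    unfolding connected_on_def P_def by blast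
  then obtain ps where ps: "P ps" and min: "\<And>qs. P qs \<Longrightarrow> length ps \<le> length qs"
    using ex_has_least_nat[of P _ length] by blast
  let ?l = "length ps"
  have ne: "ps \<noteq> []" and F: "set ps \<subseteq> F" and u: "u \<rightarrow> ps ! 0" and u': "u' \<rightarrow> ps ! (?l - 1)"
    and adj: "\<And>i. Suc i < ?l \<Longrightarrow> ps ! i \<rightarrow> ps ! Suc i"
    using ps by (auto simp: P_def hd_conv_nth last_conv_nth successively_conv_nth)
  have succ: "successively (dominates G) (take i ps)" "successively (dominates G) (drop i ps)" for i
    using ps append_take_drop_id[of i ps] unfolding P_def by (metis successively_append_iff)+
  have subset: "set (take i ps) \<subseteq> F" "set (drop i ps) \<subseteq> F" for i
    using F set_take_subset[of i ps] set_drop_subset[of i ps] by auto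
  have hd_last: "hd (take (Suc i) ps) = hd ps" "last (take (Suc i) ps) = ps ! i"
    "hd (drop i ps) = ps ! i" "last (drop i ps) = last ps" if "i < ?l" for i
    using that by (simp_all add: hd_drop_conv_nth take_Suc_conv_app_nth[THEN arg_cong[where f = last]]
        hd_take last_drop)
  have take: "P (take (Suc i) ps)" if "i < ?l" "u' \<rightarrow> ps ! i" for i
    using that ps ne succ subset hd_last unfolding P_def by auto
  have drop: "P (drop j ps)" if "j < ?l" "u \<rightarrow> ps ! j" for j
    using that ps succ subset hd_last unfolding P_def by auto
  have shortcut: "P (take (Suc i) ps @ drop j ps)" if "i < j" "j < ?l" "ps ! i \<rightarrow> ps ! j" for i j
    using that ps ne succ subset hd_last unfolding P_def
    by (auto simp: successively_append_iff)
  have "distinct ps"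
  proof (rule ccontr)
    assume "\<not> distinct ps"
    then obtain i j where ij: "i < j" "j < ?l" "ps ! i = ps ! j"
      by (metis distinct_conv_nth linorder_neqE_nat)
    show False
    proof (cases i)
      \<comment> \<open>There is no predecessor to jump from, but \<open>ps ! j\<close> equals the
        first vertex and is thus a neighbor of \<open>u\<close>.\<close>
      case 0
      with drop[of j] ij u min show False by force
    next
      case (Suc i')
      with shortcut[of i' j] ij adj[of i'] min show False by force
    qed
  qed
  show thesis
  proof (cases "?l = 1")
    case True
    then show thesis using that[OF subsetD[OF F nth_mem]] u u' by simp
  next
    case False
    with ne have l: "2 \<le> ?l" by (cases ps) (auto simp: Suc_le_eq)
    define ws where "ws = u # ps @ [u']"
    have nth: "ws ! 0 = u" "ws ! Suc ?l = u'" "\<And>i. i < ?l \<Longrightarrow> ws ! Suc i = ps ! i"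
      by (auto simp: ws_def nth_append)
    have len: "length ws = ?l + 2" by (simp add: ws_def)
    have "u \<noteq> u'" using assms(3) dominates_irrefl by auto
    then have "distinct ws" using \<open>distinct ps\<close> F assms by (auto simp: ws_def)
    moreover have "ws ! i \<rightarrow> ws ! Suc i" if "Suc i < length ws" for i
    proof (cases i)
      case 0
      then show ?thesis using nth u ne by auto
    next
      case (Suc i')
      show ?thesis
      proof (cases "Suc i' = ?l")
        case True
        then have "ws ! i = ps ! (?l - 1)" "ws ! Suc i = u'"
          using Suc nth(2) nth(3)[of i'] by (simp_all flip: True)
        then show ?thesis using dominates_sym[OF u'] by simp
      next
        case False
        with that Suc len have "Suc i' < ?l" by simp
        then show ?thesis using adj[of i'] nth Suc by auto
      qed
    qed
    moreover have "last ws \<rightarrow> hd ws" using dominates_sym[OF assms(3)] by (simp add: ws_def)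
    ultimately obtain i j where ij: "Suc i < j" "j < length ws" "\<not> (i = 0 \<and> Suc j = length ws)"
      "ws ! i \<rightarrow> ws ! j"
      using chordal_obtain_chord[OF \<open>chordal G\<close>, of ws] l len by auto
    obtain j' where j': "j = Suc j'" using ij by (cases j) auto
    show thesis
    proof (cases i)
      case 0
      \<comment> \<open>The edge from \<open>u\<close> to \<open>u'\<close> belongs to the cycle, so
        a chord at \<open>u\<close> ends on the path, beyond its first vertex.\<close>
      then have "u \<rightarrow> ps ! j'" "j' < ?l" "0 < j'" using ij j' nth len by auto
      with drop[of j'] min have False by force
      then show ?thesis ..
    next
      case (Suc i')
      show ?thesis
      proof (cases "j' = ?l")
        case True
        then have "ps ! i' \<rightarrow> u'" "Suc i' < ?l" using ij j' nth Suc by auto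
        with take[of i'] dominates_sym min have False by force
        then show ?thesis ..
      next
        case False
        then have "ps ! i' \<rightarrow> ps ! j'" "Suc i' < j'" "j' < ?l" using ij j' nth len Suc by auto
        with shortcut[of i' j'] min have False by force
        then show ?thesis ..
      qed
    qed
  qed
qed

text \<open>Take \<open>v\<close> in \<open>F\<close> with the most neighbors in \<open>K\<close>.
  If \<open>u\<close> in \<open>K\<close> misses it, go from \<open>v\<close> through non-neighbors
  of \<open>u\<close> to a first neighbor \<open>w\<close> of \<open>u\<close>. Each
  \<open>u'\<close> in \<open>K\<close> adjacent to \<open>v\<close> has a common neighbor with
  \<open>u\<close> in this connected set, which can only be \<open>w\<close>. So \<open>w\<close>
  has more neighbors in \<open>K\<close> than \<open>v\<close>.\<close>

lemma chordal_complete_to_clique: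
  assumes "chordal G" "connected_on G F" "F \<noteq> {}" "finite F" "finite K" "F \<inter> K = {}"
    and clique: "\<And>u u'. u \<in> K \<Longrightarrow> u' \<in> K \<Longrightarrow> u \<noteq> u' \<Longrightarrow> u \<rightarrow> u'"
    and touch: "\<And>u. u \<in> K \<Longrightarrow> \<exists>a \<in> F. u \<rightarrow> a"
  obtains v where "v \<in> F" "\<And>u. u \<in> K \<Longrightarrow> u \<rightarrow> v"
proof -
  let ?N = "\<lambda>v. {u \<in> K. u \<rightarrow> v}"
  have "(MAX v\<in>F. card (?N v)) \<in> (\<lambda>v. card (?N v)) ` F"
    using assms(3,4) by (intro Max_in) auto
  then obtain v where v: "v \<in> F" and MAX: "(MAX v\<in>F. card (?N v)) = card (?N v)"
    by auto
  have max: "card (?N w) \<le> card (?N v)" if "w \<in> F" for w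
    unfolding MAX[symmetric] using that assms(4) by (intro Max_ge) auto
  have "u \<rightarrow> v" if u: "u \<in> K" for u
  proof (rule ccontr)
    assume nu: "\<not> u \<rightarrow> v"
    define F0 where "F0 = {f \<in> F. \<not> u \<rightarrow> f}"
    define C where "C = comp_of G F0 v"
    have vF0: "v \<in> F0" using v nu by (simp add: F0_def)
    have C: "C \<subseteq> F0" "v \<in> C" "connected_on G C"
      unfolding C_def using vF0 comp_of_subset comp_of_self connected_on_comp_of by metis+
    obtain a where a: "a \<in> F" "u \<rightarrow> a" using touch u by blast
    have "(v, a) \<in> (arcs_ends G \<inter> F \<times> F)\<^sup>*" using assms(2) v a by (auto simp: connected_on_def)
    \<comment> \<open>A walk from \<open>v\<close> to \<open>a\<close> either stays in
      \<open>C\<close> or leaves it; as \<open>C\<close> is a component of \<open>F0\<close>, it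
      then also leaves \<open>F0\<close>.\<close>
    then have "a \<in> C \<or> (\<exists>p \<in> C. \<exists>w \<in> F - F0. p \<rightarrow> w)"
    proof (induction rule: rtrancl_induct)
      case (step y z)
      then show ?case
        using comp_of_step[OF vF0, of y G z] unfolding C_def by (cases "z \<in> F0") auto
    qed (use C in auto)
    moreover have "a \<notin> C" using a C by (auto simp: F0_def)
    ultimately obtain p w where pw: "p \<in> C" "w \<in> F" "u \<rightarrow> w" "p \<rightarrow> w" by (auto simp: F0_def)
    have conn: "connected_on G (insert w C)" using connected_on_insert C pw by blast
    have "u' \<rightarrow> w" if u': "u' \<in> K" "u' \<rightarrow> v" for u'
    proof -
      have "u \<noteq> u'" using u' nu by auto
      moreover have "u \<notin> insert w C" "u' \<notin> insert w C"
        using u u' C pw \<open>F \<inter> K = {}\<close> by (auto simp: F0_def)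
      ultimately obtain z where z: "z \<in> insert w C" "u \<rightarrow> z" "u' \<rightarrow> z"
        using chordal_common_neighbor[OF \<open>chordal G\<close> conn, of u u' w v] clique u u' pw C by auto
      then have "z = w" using C by (auto simp: F0_def)
      with z show ?thesis by simp
    qed
    then have "insert u (?N v) \<subseteq> ?N w" using u pw by auto
    then have "card (insert u (?N v)) \<le> card (?N w)" using \<open>finite K\<close> by (intro card_mono) auto
    then have "card (?N v) < card (?N w)" using nu \<open>finite K\<close> by simp
    with max[OF pw(2)] show False by simp
  qed
  with that v show thesis by blast
qed

end

section \<open>Colorings\<close>

definition sees :: "('a, 'b) pre_digraph \<Rightarrow> ('a \<Rightarrow> nat) \<Rightarrow> 'a \<Rightarrow> nat \<Rightarrow> bool" where
  "sees G c v j \<longleftrightarrow> (\<exists>w \<in> verts G. v \<rightarrow>\<^bsub>G\<^esub> w \<and> c w = j)"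

text \<open>The color set \<open>L\<close> is a parameter so that colors can be discarded without
  renaming the others.\<close>

definition b_vertex :: "('a, 'b) pre_digraph \<Rightarrow> ('a \<Rightarrow> nat) \<Rightarrow> nat set \<Rightarrow> 'a \<Rightarrow> bool" where
  "b_vertex G c L v \<longleftrightarrow> v \<in> verts G \<and> (\<forall>j \<in> L - {c v}. sees G c v j)"

lemma b_coloring_iff:
  "b_coloring G k c \<longleftrightarrow> c ` verts G \<subseteq> {..<k} \<and> proper_coloring G c \<and>
    (\<forall>i < k. \<exists>v. c v = i \<and> b_vertex G c {..<k} v)"
proof -
  have "(\<exists>v \<in> verts G. c v = i \<and> (\<forall>j < k. j \<noteq> i \<longrightarrow> (\<exists>w \<in> verts G. v \<rightarrow>\<^bsub>G\<^esub> w \<and> c w = j))) \<longleftrightarrow>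
      (\<exists>v. c v = i \<and> b_vertex G c {..<k} v)" for i
    unfolding Bex_def[of "verts G" "\<lambda>v. c v = i \<and> _ v"]
    by (intro ex_cong1) (auto simp: b_vertex_def sees_def)
  then show ?thesis by (simp add: b_coloring_def)
qed

lemma b_coloring_le_card:
  assumes "finite (verts G)" "b_coloring G k c"
  shows "k \<le> card (verts G)"
proof -
  have "{..<k} \<subseteq> c ` verts G" using assms by (auto simp: b_coloring_def)
  then have "card {..<k} \<le> card (verts G)" using assms(1) surj_card_le by blast
  then show ?thesis by simp
qed

lemma finite_b_colorings:
  assumes "finite (verts G)"
  shows "finite {k. \<exists>c. b_coloring G k c}"
  by (rule finite_subset[of _ "{..card (verts G)}"]) (use assms b_coloring_le_card in auto)

section \<open>Relabeling and dissolving color classes\<close>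

context graph
begin

text \<open>The remaining colors need not be an initial segment of the naturals; a bijection onto
  one preserves properness and b-vertices.\<close>

lemma b_coloring_relabel:
  assumes "finite L" "c ` verts G \<subseteq> L" "proper_coloring G c"
    and rep: "\<And>l. l \<in> L \<Longrightarrow> \<exists>v. c v = l \<and> b_vertex G c L v"
  shows "\<exists>c'. b_coloring G (card L) c'"
proof -
  obtain h where h: "bij_betw h L {..<card L}"
    using \<open>finite L\<close> ex_bij_betw_finite_nat[of L] by (auto simp: atLeast0LessThan)
  have inj: "inj_on h L" and img: "h ` L = {..<card L}" using h by (auto simp: bij_betw_def)
  have cL: "c v \<in> L" if "v \<in> verts G" for v using that assms(2) by auto
  have "proper_coloring G (h \<circ> c)"
    unfolding proper_coloring_def
  proof (intro ballI impI)
    fix u v assume "u \<in> verts G" "v \<in> verts G" "u \<rightarrow> v"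
    then have "c u \<in> L" "c v \<in> L" "c u \<noteq> c v" using assms(3) cL by (auto simp: proper_coloring_def)
    then show "(h \<circ> c) u \<noteq> (h \<circ> c) v" using inj by (simp add: inj_on_eq_iff)
  qed
  moreover have "\<exists>v. (h \<circ> c) v = i \<and> b_vertex G (h \<circ> c) {..<card L} v" if "i < card L" for i
  proof -
    have "i \<in> h ` L" using that by (simp add: img)
    then obtain l where l: "l \<in> L" "h l = i" by blast
    obtain v where v: "c v = l" "b_vertex G c L v" using rep l by blast
    have "sees G (h \<circ> c) v j" if "j \<in> {..<card L} - {i}" for j
    proof -
      have "j \<in> h ` L" using that by (simp add: img)
      then obtain m where m: "m \<in> L" "h m = j" by blast
      then have "m \<in> L - {c v}" using l v that by auto
      then obtain w where "w \<in> verts G" "v \<rightarrow> w" "c w = m"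
        using v(2) unfolding b_vertex_def sees_def by blast
      then show ?thesis using m by (auto simp: sees_def)
    qed
    then show ?thesis using v l by (intro exI[of _ v]) (simp add: b_vertex_def)
  qed
  moreover have "(h \<circ> c) ` verts G \<subseteq> {..<card L}"
    unfolding image_comp[symmetric] img[symmetric] using assms(2) by (rule image_mono)
  ultimately have "b_coloring G (card L) (h \<circ> c)" unfolding b_coloring_iff by blast
  then show ?thesis by (rule exI[of _ "h \<circ> c"])
qed

text \<open>A color class without b-vertex can be dissolved: each of its vertices misses some color.\<close>

lemma ex_b_coloring_ge:
  assumes "finite L" "c ` verts G \<subseteq> L" "proper_coloring G c" "S \<subseteq> L"
    and "\<And>s. s \<in> S \<Longrightarrow> \<exists>v. c v = s \<and> b_vertex G c L v"
  shows "\<exists>k \<ge> card S. \<exists>c. b_coloring G k c"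
  using assms
proof (induction "card L" arbitrary: L c rule: less_induct)
  case less
  show ?case
  proof (cases "\<forall>l \<in> L. \<exists>v. c v = l \<and> b_vertex G c L v")
    case True
    then have "\<exists>c'. b_coloring G (card L) c'"
      using less.prems(1-3) by (intro b_coloring_relabel) auto
    moreover have "card S \<le> card L" using less.prems(1,4) by (rule card_mono)
    ultimately show ?thesis by (intro exI[of _ "card L"] conjI)
  next
    case False
    then obtain l where l: "l \<in> L" "\<And>v. c v = l \<Longrightarrow> \<not> b_vertex G c L v" by blast
    have "\<exists>d. d \<in> L - {l} \<and> \<not> sees G c v d" if "v \<in> verts G" "c v = l" for v
      using l(2)[OF that(2)] that by (auto simp: b_vertex_def)
    then obtain d where d: "\<And>v. v \<in> verts G \<Longrightarrow> c v = l \<Longrightarrow> d v \<in> L - {l} \<and> \<not> sees G c v (d v)"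
      by metis
    define c' where "c' v = (if c v = l then d v else c v)" for v
    \<comment> \<open>Two recolored vertices share the color \<open>l\<close>, so they are not
      adjacent; a recolored vertex avoids the colors of all its neighbors.\<close>
    have proper: "proper_coloring G c'"
      unfolding proper_coloring_def
    proof (intro ballI impI)
      fix u v assume uv: "u \<in> verts G" "v \<in> verts G" "u \<rightarrow> v"
      then have "c u \<noteq> c v" "v \<rightarrow> u"
        using less.prems(3) dominates_sym by (auto simp: proper_coloring_def)
      then show "c' u \<noteq> c' v"
        using uv d[of u] d[of v] by (auto simp: c'_def sees_def)
    qed
    have range: "c' ` verts G \<subseteq> L - {l}"
    proof (rule image_subsetI)
      fix v assume "v \<in> verts G"
      then show "c' v \<in> L - {l}" using d[of v] less.prems(2) by (auto simp: c'_def)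
    qed
    have "l \<notin> S" using less.prems(5)[of l] l(2) by blast
    then have S: "S \<subseteq> L - {l}" using less.prems(4) by blast
    have reps: "\<exists>v. c' v = s \<and> b_vertex G c' (L - {l}) v" if "s \<in> S" for s
    proof -
      obtain v where v: "c v = s" "b_vertex G c L v" using less.prems(5) \<open>s \<in> S\<close> by blast
      have "s \<noteq> l" using \<open>s \<in> S\<close> \<open>l \<notin> S\<close> by blast
      have "sees G c' v j" if "j \<in> L - {l} - {s}" for j
      proof -
        have "sees G c v j" using v that by (simp add: b_vertex_def)
        then obtain w where w: "w \<in> verts G" "v \<rightarrow> w" "c w = j" unfolding sees_def by blast
        then have "c' w = j" using that by (simp add: c'_def)
        with w show ?thesis unfolding sees_def by blast
      qed
      then show ?thesis
        using v \<open>s \<noteq> l\<close> by (intro exI[of _ v]) (auto simp: c'_def b_vertex_def)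
    qed
    have "card (L - {l}) < card L" using less.prems(1) l(1) by (rule card_Diff1_less)
    then show ?thesis
      using less.prems(1) by (intro less.hyps[OF _ _ range proper S reps]) simp_all
  qed
qed

lemma b_chromatic_number_ge:
  assumes "finite L" "c ` verts G \<subseteq> L" "proper_coloring G c" "S \<subseteq> L"
    and "\<And>s. s \<in> S \<Longrightarrow> \<exists>v. c v = s \<and> b_vertex G c L v"
  shows "card S \<le> b_chromatic_number G"
proof -
  obtain k where "card S \<le> k" "k \<in> {k. \<exists>c. b_coloring G k c}"
    using ex_b_coloring_ge[OF assms] by blast
  then show ?thesis
    unfolding b_chromatic_number_def
    using Max_ge[OF finite_b_colorings[OF finite_verts]] le_trans by blast
qed

text \<open>Coloring all vertices differently and dissolving classes yields some b-coloring, so the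
  maximum is attained.\<close>

lemma ex_b_coloring_b_chromatic_number: "\<exists>c. b_coloring G (b_chromatic_number G) c"
proof -
  obtain f :: "'a \<Rightarrow> nat" where f: "inj_on f (verts G)"
    using finite_imp_inj_to_nat_seg[OF finite_verts] by blast
  have "proper_coloring G f"
    using dominates_irrefl f unfolding proper_coloring_def by (metis inj_onD)
  then have "{k. \<exists>c. b_coloring G k c} \<noteq> {}"
    using ex_b_coloring_ge[of "f ` verts G" f "{}"] by auto
  then show ?thesis
    unfolding b_chromatic_number_def using Max_in[OF finite_b_colorings[OF finite_verts]] by blast
qed

lemma card_clique_le:
  assumes "is_clique G K"
  shows "card K \<le> clique_number G"
proof -
  have "{card K | K. is_clique G K} \<subseteq> {..card (verts G)}"
    by (auto simp: is_clique_def intro: card_mono)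
  then have "finite {card K | K. is_clique G K}" by (rule finite_subset) simp
  then show ?thesis unfolding clique_number_def using assms by (intro Max_ge) auto
qed

end

section \<open>Removing the color of the deleted vertex\<close>

definition clique_attached :: "('a, 'b) pre_digraph \<Rightarrow> 'a set \<Rightarrow> bool" where
  "clique_attached G U \<longleftrightarrow> (\<forall>v \<in> verts G - U. \<forall>a \<in> U. \<forall>b \<in> U. a \<noteq> b \<longrightarrow>
     (\<exists>y \<in> comp_of G (verts G - U) v. a \<rightarrow>\<^bsub>G\<^esub> y) \<longrightarrow>
     (\<exists>y \<in> comp_of G (verts G - U) v. b \<rightarrow>\<^bsub>G\<^esub> y) \<longrightarrow> a \<rightarrow>\<^bsub>G\<^esub> b)"

context graph
begin

text \<open>Components of the smaller rest lie inside old ones, which settles pairs from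
  \<open>U\<close>. A component touching \<open>v\<close> came from that of \<open>v\<close>, and by
  \<open>complete\<close> every vertex of \<open>U\<close> touching it is adjacent to
  \<open>v\<close>.\<close>

lemma clique_attached_insert:
  assumes att: "clique_attached G U" and v: "v \<in> verts G - U"
    and complete: "\<And>u y. u \<in> U \<Longrightarrow> y \<in> comp_of G (verts G - U) v \<Longrightarrow> u \<rightarrow> y \<Longrightarrow> u \<rightarrow> v"
  shows "clique_attached G (insert v U)"
  unfolding clique_attached_def
proof (intro ballI impI)
  let ?F = "comp_of G (verts G - U)" and ?F' = "comp_of G (verts G - insert v U)"
  fix w a b
  assume w: "w \<in> verts G - insert v U" and ab: "a \<in> insert v U" "b \<in> insert v U" "a \<noteq> b"
    and "\<exists>y \<in> ?F' w. a \<rightarrow> y" "\<exists>y \<in> ?F' w. b \<rightarrow> y"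
  moreover have "?F' w \<subseteq> ?F w" by (rule comp_of_mono) auto
  ultimately have touch: "\<exists>y \<in> ?F w. a \<rightarrow> y" "\<exists>y \<in> ?F w. b \<rightarrow> y" by blast+
  have same: "?F w = ?F v" if "\<exists>y \<in> ?F w. v \<rightarrow> y"
    using that comp_of_step[of w "verts G - U" _ G v] comp_of_eq[of v "verts G - U" w]
      dominates_sym v w by blast
  consider "a = v" "b \<in> U" | "b = v" "a \<in> U" | "a \<in> U" "b \<in> U" using ab by blast
  then show "a \<rightarrow> b"
  proof cases
    case 1
    then show ?thesis using same touch complete dominates_sym by blast
  next
    case 2
    then show ?thesis using same touch complete by blast
  next
    case 3
    then show ?thesis using att w touch ab unfolding clique_attached_def by blast
  qed
qed

text \<open>\<open>U\<close> is the set of swept vertices and \<open>q h\<close> the b-vertex kept for color \<open>h\<close>. After colors \<open>z\<close>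
  and \<open>j\<close> are exchanged in \<open>F\<close>, the vertices of \<open>K\<close> see \<open>j\<close> at \<open>v\<close>; those in \<open>F\<close> keep seeing \<open>j\<close>
  because they saw \<open>z\<close>; and \<open>q j\<close> is not in \<open>F\<close> because \<open>F\<close> contains no neighbor of \<open>x\<close>.\<close>

lemma remove_color:
  assumes "chordal G" "M \<subseteq> L - {z}" "clique_number G \<le> card M" "finite L"
    and M: "\<And>h. h \<in> M \<Longrightarrow> x \<rightarrow> q h"
    and "x \<in> U" "U \<subseteq> verts G" "clique_attached G U"
    and "proper_coloring G c" "c ` verts G \<subseteq> L" "c x = z" "\<And>u. u \<in> U - {x} \<Longrightarrow> c u \<noteq> z"
    and "\<And>h. h \<in> L - {z} \<Longrightarrow> q h \<in> verts G \<and> c (q h) = h"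
    and "\<And>h g. h \<in> L - {z} \<Longrightarrow> g \<in> L - {z, h} \<Longrightarrow> sees G c (q h) g"
    and "\<And>h. h \<in> L - {z} - M \<Longrightarrow> q h \<notin> U \<Longrightarrow> \<exists>w \<in> verts G - {x}. q h \<rightarrow> w \<and> c w = z"
  shows "\<exists>c'. proper_coloring G c' \<and> c' ` verts G \<subseteq> L \<and> c' x = z \<and> (\<forall>u \<in> verts G - {x}. c' u \<noteq> z) \<and>
    (\<forall>h \<in> L - {z}. q h \<in> verts G \<and> c' (q h) = h \<and> (\<forall>g \<in> L - {z, h}. sees G c' (q h) g))"
  \<comment> \<open>Only the assumptions on \<open>U\<close> and \<open>c\<close> vary during the
    sweep. The last one is restricted to unswept \<open>q h\<close>, as swept vertices never lie in
    \<open>F\<close>.\<close>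
  using assms(6-)
proof (induction "card (verts G - U)" arbitrary: U c rule: less_induct)
  case less
  note x = less.prems(1) and U = less.prems(2) and att = less.prems(3)
    and proper = less.prems(4) and cL = less.prems(5) and cx = less.prems(6)
    and noz = less.prems(7) and q = less.prems(8) and sees = less.prems(9)
    and seesz = less.prems(10)
  show ?case
  proof (cases "verts G - U = {}")
    case True
    then have "U = verts G" using U by blast
    then show ?thesis using proper cL cx noz q sees by (intro exI[of _ c]) blast
  next
    case False
    then obtain v0 where v0: "v0 \<in> verts G - U" by blast
    define F where "F = comp_of G (verts G - U) v0"
    define K where "K = {u \<in> U. \<exists>y \<in> F. u \<rightarrow> y}"
    have F: "F \<subseteq> verts G - U" "v0 \<in> F" "connected_on G F"
      using comp_of_subset[OF v0] comp_of_self connected_on_comp_of[OF v0] by (auto simp: F_def)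
    have KU: "K \<subseteq> U" "K \<subseteq> verts G" using U by (auto simp: K_def)
    have K: "u \<rightarrow> u'" if "u \<in> K" "u' \<in> K" "u \<noteq> u'" for u u'
      using att v0 that unfolding clique_attached_def K_def F_def by blast
    have nbr: "u \<in> F \<or> u \<in> K" if "y \<in> F" "y \<rightarrow> u" for u y
      using that comp_of_step[OF v0, of y G u] dominates_sym[OF that(2)] adj_in_verts(2)[OF that(2)]
      unfolding F_def[symmetric] K_def by blast
    have fin: "finite F" "finite K"
      using F(1) KU(2) finite_verts by (auto intro: finite_subset)
    obtain v where v: "v \<in> F" "\<And>u. u \<in> K \<Longrightarrow> u \<rightarrow> v"
      using chordal_complete_to_clique[OF assms(1) F(3) _ fin _ K] F KU
      unfolding K_def by blast
    have vU: "v \<in> verts G - U" using v F by blast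
    have Fv: "comp_of G (verts G - U) v = F" using comp_of_eq v(1) by (auto simp: F_def)
    have att': "clique_attached G (insert v U)"
      by (rule clique_attached_insert[OF att vU]) (use v Fv in \<open>auto simp: K_def\<close>)
    have "verts G - insert v U \<subset> verts G - U" using vU by blast
    then have smaller: "card (verts G - insert v U) < card (verts G - U)"
      by (simp add: psubset_card_mono)
    have U': "x \<in> insert v U" "insert v U \<subseteq> verts G" using x U vU by auto
    show ?thesis
    proof (cases "c v = z")
      case False
      then show ?thesis
        using noz seesz by (intro less.hyps[OF smaller U' att' proper cL cx _ q sees]) auto
    next
      case True
      \<comment> \<open>\<open>x\<close> and \<open>v\<close> share the color \<open>z\<close>, so
        they are not adjacent, whereas \<open>K\<close> is complete to \<open>v\<close>.\<close>
      have xK: "x \<notin> K"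
        using v(2)[of x] True cx proper vU x U unfolding proper_coloring_def by auto
      have KM: "c u \<noteq> z" if "u \<in> K" for u using noz that KU xK by blast
      have "is_clique G (insert v K)"
        using K v vU KU dominates_sym by (auto simp: is_clique_def)
      moreover have "v \<notin> K" using vU KU by blast
      ultimately have "card K < card M"
        using card_clique_le[of "insert v K"] assms(3) fin by simp
      then have "card (c ` K) < card M" using card_image_le[OF fin(2), of c] by linarith
      then obtain j where j: "j \<in> M" "j \<notin> c ` K"
        using card_mono[of "c ` K" M] fin by force
      then have jL: "j \<in> L - {z}" using assms(2) by blast
      \<comment> \<open>The exchange stays proper at the border of \<open>F\<close> because
        \<open>K\<close> carries neither \<open>z\<close> nor \<open>j\<close>.\<close>
      define s where "s w = (if w \<in> F then Transposition.transpose z j (c w) else c w)" for w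
      have sF: "s w = (if c w = z then j else if c w = j then z else c w)" if "w \<in> F" for w
        using that by (simp add: s_def transpose_def)
      have sn: "s w = c w" if "w \<notin> F" for w using that by (simp add: s_def)
      have Kc: "s u = c u" "c u \<noteq> z" "c u \<noteq> j" if "u \<in> K" for u
        using that KM j(2) sn[of u] F KU by auto
      have xF: "x \<notin> F" using x F by blast
      \<comment> \<open>The swept vertex \<open>x\<close> is not in \<open>K\<close>, so it has no
        neighbor in \<open>F\<close>.\<close>
      have qM: "q h \<notin> F" if "h \<in> M" for h
        using M[OF that] xK x by (auto simp: K_def)
      have proper': "proper_coloring G s"
        unfolding proper_coloring_def
      proof (intro ballI impI)
        fix a b assume ab: "a \<in> verts G" "b \<in> verts G" "a \<rightarrow> b"
        then have ne: "c a \<noteq> c b" using proper by (auto simp: proper_coloring_def)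
        consider "a \<in> F" "b \<in> F" | "a \<in> F" "b \<in> K" | "a \<in> K" "b \<in> F" | "a \<notin> F" "b \<notin> F"
          using nbr[of a b] nbr[of b a] ab dominates_sym by blast
        then show "s a \<noteq> s b"
          using ne Kc[of a] Kc[of b] by cases (auto simp: sF sn)
      qed
      have range: "s ` verts G \<subseteq> L" using cL jL cx U x by (auto simp: s_def transpose_def)
      have noz': "s u \<noteq> z" if "u \<in> insert v U - {x}" for u
      proof (cases "u = v")
        case True
        then show ?thesis using sF[OF v(1)] \<open>c v = z\<close> jL by simp
      next
        case False
        then have u: "u \<in> U - {x}" using that by blast
        then have "u \<notin> F" using F(1) by blast
        then show ?thesis using noz[OF u] sn by simp
      qed
      have q': "q h \<in> verts G \<and> s (q h) = h" if "h \<in> L - {z}" for h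
      proof (cases "q h \<in> F")
        case True
        then have "h \<noteq> j" using qM j by blast
        with True show ?thesis using q[OF that] that sF by auto
      qed (use q[OF that] sn in auto)
      have sees': "sees G s (q h) g" if h: "h \<in> L - {z}" and g: "g \<in> L - {z, h}" for h g
      proof -
        obtain w where w: "w \<in> verts G" "q h \<rightarrow> w" "c w = g"
          using sees[OF h g] by (auto simp: sees_def)
        \<comment> \<open>Since \<open>g\<close> is not \<open>z\<close>, the witness changes its
          color only if it has color \<open>j\<close> and lies in \<open>F\<close>.\<close>
        consider "s w = g" | "w \<in> F" "g = j" using w g sF[of w] sn[of w] by fastforce
        then show ?thesis
        proof cases
          case 1
          then show ?thesis using w by (auto simp: sees_def)
        next
          case 2
          show ?thesis
          proof (cases "q h \<in> F")
            case True
            then have "h \<notin> M" "q h \<notin> U" using qM F by blast+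
            then obtain w' where w': "w' \<in> verts G" "q h \<rightarrow> w'" "c w' = z"
              using seesz h by blast
            then have "w' \<in> F" using nbr[OF True] Kc(2) by blast
            then show ?thesis using w' 2 sF[of w'] by (auto simp: sees_def)
          next
            case False
            then have "q h \<in> K" using nbr[OF 2(1) dominates_sym[OF w(2)]] by blast
            then show ?thesis
              using v 2 vU True sF[of v] by (auto simp: sees_def)
          qed
        qed
      qed
      have seesz': "\<exists>w \<in> verts G - {x}. q h \<rightarrow> w \<and> s w = z"
        if h: "h \<in> L - {z} - M" and hU: "q h \<notin> insert v U" for h
      proof -
        obtain w where w: "w \<in> verts G - {x}" "q h \<rightarrow> w" "c w = z" using seesz h hU by blast
        show ?thesis
        proof (cases "w \<in> F")
          case True
          then have "q h \<in> F" using nbr[of w "q h"] dominates_sym[OF w(2)] KU hU True by blast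
          \<comment> \<open>\<open>h\<close> is outside \<open>M\<close> and hence different from
            \<open>j\<close>, so \<open>q h\<close> sees \<open>j\<close>; this happens inside
            \<open>F\<close>, where \<open>j\<close> turns into \<open>z\<close>.\<close>
          have "g \<noteq> h" if "g \<in> M" for g using that h by blast
          then have "j \<in> L - {z, h}" using j jL by blast
          then obtain y where y: "y \<in> verts G" "q h \<rightarrow> y" "c y = j"
            using sees[of h j] h by (auto simp: sees_def)
          then have "y \<in> F" using nbr[OF \<open>q h \<in> F\<close>] Kc(3) by blast
          then show ?thesis using y sF[of y] xF jL by auto
        qed (use w sn in auto)
      qed
      show ?thesis
        by (rule less.hyps[OF smaller U' att' proper' range _ noz' q' sees' seesz'])
          (use xF sn cx in auto)
    qed
  qed
qed

end

section \<open>Deleting a vertex\<close>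

lemma (in graph) graph_del_vert: "graph (del_vert x)"
proof -
  interpret D: fin_digraph "del_vert x" by (rule fin_digraph_del_vert)
  show ?thesis
    using no_loops no_multi_arcs sym_arcs
    by unfold_locales (auto simp: del_vert_simps ends_del_vert symmetric_conv)
qed

lemma (in graph) dominates_del_vert:
  "u \<rightarrow>\<^bsub>del_vert x\<^esub> v \<longleftrightarrow> u \<rightarrow> v \<and> u \<noteq> x \<and> v \<noteq> x"
  by (auto simp: arcs_ends_conv del_vert_simps)

theorem theorem5:
  fixes G :: "('a, 'b) pre_digraph" and x :: 'a
  assumes "graph G"
    and "chordal G"
    and "x \<in> verts G"
  shows "int (b_chromatic_number (pre_digraph.del_vert G x))
           \<ge> int (b_chromatic_number G) - int (clique_number G)"
proof -
  interpret graph G by fact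
  interpret D: graph "del_vert x" by (rule graph_del_vert)
  let ?D = "del_vert x" and ?k = "b_chromatic_number G" and ?w = "clique_number G"
  obtain c where c: "b_coloring G ?k c" using ex_b_coloring_b_chromatic_number by blast
  define L where "L = {..<?k}"
  define z where "z = c x"
  have proper: "proper_coloring G c" and cL: "c ` verts G \<subseteq> L"
    and rep: "\<And>h. h \<in> L \<Longrightarrow> \<exists>v. c v = h \<and> b_vertex G c L v"
    using c by (auto simp: b_coloring_iff L_def)
  have z: "z \<in> L" using cL assms(3) by (auto simp: z_def)
  have L: "finite L" "card L = ?k" by (simp_all add: L_def)
  \<comment> \<open>The bound on \<open>?w\<close> pays for the color \<open>z\<close> when
    \<open>z\<close> is the only color lost.\<close>
  have "is_clique G {x}" using assms(3) by (simp add: is_clique_def)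
  then have w: "1 \<le> ?w" using card_clique_le by fastforce
  define M where "M = {h \<in> L - {z}. \<nexists>v. c v = h \<and> b_vertex ?D c L v}"
  have proper_D: "proper_coloring ?D c'" if "proper_coloring G c'" for c'
    using that by (auto simp: proper_coloring_def dominates_del_vert verts_del_vert)
  have "?k - ?w \<le> b_chromatic_number ?D"
  proof (cases "?w \<le> card M")
    case False
    \<comment> \<open>The colors kept have b-vertices under the unchanged \<open>c\<close>; at most
      \<open>?w - 1\<close> colors of \<open>M\<close> and the color \<open>z\<close> are given
      up.\<close>
    have "card (L - {z} - M) \<le> b_chromatic_number ?D"
      by (rule D.b_chromatic_number_ge[OF L(1) _ proper_D[OF proper]])
        (use cL in \<open>auto simp: M_def verts_del_vert\<close>)
    moreover have "card (L - {z} - M) = ?k - 1 - card M"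
      using L z by (subst card_Diff_subset) (auto simp: M_def)
    ultimately show ?thesis using False by linarith
  next
    case True
    \<comment> \<open>For colors outside \<open>M\<close> the representative survives the deletion,
      so it has a neighbor of color \<open>z\<close> other than \<open>x\<close>.\<close>
    have "\<exists>v. c v = h \<and> b_vertex G c L v \<and> (h \<notin> M \<longrightarrow> b_vertex ?D c L v)"
      if h: "h \<in> L - {z}" for h
    proof (cases "h \<in> M")
      case False
      then obtain v where v: "c v = h" "b_vertex ?D c L v" using h unfolding M_def by blast
      then have "b_vertex G c L v"
        by (fastforce simp: b_vertex_def sees_def verts_del_vert dominates_del_vert)
      with v show ?thesis by blast
    qed (use rep h in blast)
    then obtain q where q: "\<And>h. h \<in> L - {z} \<Longrightarrow>
        c (q h) = h \<and> b_vertex G c L (q h) \<and> (h \<notin> M \<longrightarrow> b_vertex ?D c L (q h))"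
      by metis
    have qM: "x \<rightarrow>\<^bsub>G\<^esub> q h" if "h \<in> M" for h
    proof (rule ccontr)
      assume "\<not> x \<rightarrow>\<^bsub>G\<^esub> q h"
      have h: "h \<in> L - {z}" using that by (simp add: M_def)
      then have "q h \<noteq> x" using q[OF h] by (auto simp: z_def)
      \<comment> \<open>A vertex other than \<open>x\<close> that is not adjacent to
        \<open>x\<close> keeps all its neighbors.\<close>
      with q[OF h] \<open>\<not> x \<rightarrow>\<^bsub>G\<^esub> q h\<close> have "b_vertex ?D c L (q h)"
        unfolding b_vertex_def sees_def verts_del_vert dominates_del_vert
        using dominates_sym by blast
      with q[OF h] that show False by (auto simp: M_def)
    qed
    have "\<exists>c'. proper_coloring G c' \<and> c' ` verts G \<subseteq> L \<and> c' x = z \<and> (\<forall>u \<in> verts G - {x}. c' u \<noteq> z) \<and>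
        (\<forall>h \<in> L - {z}. q h \<in> verts G \<and> c' (q h) = h \<and> (\<forall>g \<in> L - {z, h}. sees G c' (q h) g))"
    proof (rule remove_color[where U = "{x}", OF assms(2) _ True L(1) qM _ _ _ proper cL])
      show "M \<subseteq> L - {z}" by (auto simp: M_def)
      show "clique_attached G {x}" by (simp add: clique_attached_def)
      show "sees G c (q h) g" if "h \<in> L - {z}" "g \<in> L - {z, h}" for h g
        using q[OF that(1)] that(2) by (auto simp: b_vertex_def)
      show "\<exists>w \<in> verts G - {x}. q h \<rightarrow>\<^bsub>G\<^esub> w \<and> c w = z" if "h \<in> L - {z} - M" for h
        using q[of h] that z
        by (fastforce simp: b_vertex_def sees_def verts_del_vert dominates_del_vert)
    qed (use assms(3) q in \<open>auto simp: z_def b_vertex_def\<close>)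
    then obtain c' where c': "proper_coloring G c'" "c' ` verts G \<subseteq> L" "c' x = z"
      "\<And>u. u \<in> verts G - {x} \<Longrightarrow> c' u \<noteq> z"
      "\<And>h. h \<in> L - {z} \<Longrightarrow> q h \<in> verts G \<and> c' (q h) = h"
      "\<And>h g. h \<in> L - {z} \<Longrightarrow> g \<in> L - {z, h} \<Longrightarrow> sees G c' (q h) g"
      by blast
    \<comment> \<open>Under \<open>c'\<close> only \<open>x\<close> has color \<open>z\<close>, so
      deleting \<open>x\<close> frees this color and every other color keeps its
      representative.\<close>
    have "card (L - {z}) \<le> b_chromatic_number ?D"
    proof (rule D.b_chromatic_number_ge[OF _ _ proper_D[OF c'(1)] subset_refl])
      show "c' ` verts ?D \<subseteq> L - {z}" using c'(2,4) by (auto simp: verts_del_vert)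
      fix h assume h: "h \<in> L - {z}"
      have "q h \<noteq> x" using c'(3) c'(5)[OF h] h by auto
      have "sees ?D c' (q h) g" if g: "g \<in> L - {z} - {h}" for g
      proof -
        obtain w where w: "w \<in> verts G" "q h \<rightarrow>\<^bsub>G\<^esub> w" "c' w = g"
          using c'(6)[OF h, of g] g by (auto simp: sees_def)
        then have "w \<noteq> x" using c'(3) g by auto
        with w \<open>q h \<noteq> x\<close> show ?thesis
          by (auto simp: sees_def verts_del_vert dominates_del_vert)
      qed
      then show "\<exists>v. c' v = h \<and> b_vertex ?D c' (L - {z}) v"
        using c'(5)[OF h] \<open>q h \<noteq> x\<close>
        by (intro exI[of _ "q h"]) (auto simp: b_vertex_def verts_del_vert)
    qed (use L in simp)
    then show ?thesis using L z w by simp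
  qed
  then show ?thesis by linarith
qed

end
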